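(* Let $\Omega$ be an at most countable set, $\mathcal{F}=2^\Omega$, and let $(\Omega_t^+)_{t\in\mathbb{N}_0}$, $(\Omega_t^-)_{t\in\mathbb{N}_0}$ be the sequences of actual and latent parts of $\Omega$ produced by a discovery process. Let $P$ be a (countably additive) probability measure on $(\Omega,\mathcal{F})$ (the oracle probability measure), let $P_0^{ex}$ be the extended probability induced by $P$ at time $0$, let $(P_t^{ex})_{t\in\mathbb{N}_0}$ be the sequence of its successive updates along the discovery process, and let $P_\infty^{ex}$ be the set function on $\mathcal{F}$, additive on disjoint events, with $$P^{ex}_\infty\Big(A\cap\bigcup_{t\in\mathbb{N}_0}\Omega_t^+\Big)=P\Big(A\cap\bigcup_{t\in\mathbb{N}_0}\Omega_t^+\Big),\qquad P^{ex}_\infty\Big(A\cap\bigcap_{t\in\mathbb{N}_0}\Omega_t^-\Big)=-P\Big(A\cap\bigcap_{t\in\mathbb{N}_0}\Omega_t^-\Big)$$ for all $A\in\mathcal{F}$. Then $P^{ex}_t\to P^{ex}_\infty$ as $t\to\infty$ in the extended total variation metric, i.e. $d_{ETV}(P_t^{ex},P_\infty^{ex})\to 0$ as $t\to\infty$.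
   Context: Notation: $\mathbb{N}_0=\mathbb{N}\cup\{0\}$; $\sqcup$ denotes disjoint union. Discovery process: at every time $t\in\mathbb{N}_0$, $\Omega=\Omega_t^-\sqcup\Omega_t^+$, with $\Omega_0^+\neq\emptyset$. At time $t+1$ an element $\omega\in\Omega$ is observed. If $\omega\in\Omega_t^-$, then $\Omega_{t+1}^+=\Omega_t^+\sqcup\{\omega\}$ and $\Omega_{t+1}^-=\Omega_t^-\setminus\{\omega\}$; if $\omega\in\Omega_t^+$, then $\Omega_{t+1}^\pm=\Omega_t^\pm$. In particular $\Omega_t^+\subset\Omega_{t+1}^+$ and $\Omega_t^-\supset\Omega_{t+1}^-$ for all $t$. Induced extended probability at time $0$: $P_0^{ex}$ is the finite signed measure on $\mathcal{F}$ with $P_0^{ex}(A\cap\Omega_0^+)=P(A\cap\Omega_0^+)$ and $P_0^{ex}(A\cap\Omega_0^-)=-P(A\cap\Omega_0^-)$ for all $A\in\mathcal{F}$. Update from $t$ to $t+1$: if the element $\omega$ observed at time $t+1$ lies in $\Omega_t^-$, then $P_{t+1}^{ex}(\{\omega\})=|P_t^{ex}(\{\omega\})|$ and $P_{t+1}^{ex}(\{\omega'\})=P_t^{ex}(\{\omega'\})$ for every $\omega'\ne\omega$; if it lies in $\Omega_t^+$, then $P_{t+1}^{ex}=P_t^{ex}$. Values on general $A\in\mathcal{F}$ are obtained by countable additivity. Extended total variation metric: $d_{ETV}(P^{ex},Q^{ex})=\sup_{A\in\mathcal{F}}|P^{ex}(A)-Q^{ex}(A)|$. *)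

theory Defs
  imports "HOL-Probability.Probability_Measure"
begin

(* obs (Suc t) is the element observed at time t + 1; the value obs 0 is irrelevant. *)
definition discovery_process ::
  "'a set \<Rightarrow> (nat \<Rightarrow> 'a set) \<Rightarrow> (nat \<Rightarrow> 'a set) \<Rightarrow> (nat \<Rightarrow> 'a) \<Rightarrow> bool" where
  "discovery_process \<Omega> Op Om obs \<longleftrightarrow>
     (\<forall>t. \<Omega> = Om t \<union> Op t \<and> Om t \<inter> Op t = {}) \<and>
     Op 0 \<noteq> {} \<and>
     (\<forall>t. obs (Suc t) \<in> \<Omega> \<and>
        (obs (Suc t) \<in> Om t \<longrightarrow>
           Op (Suc t) = Op t \<union> {obs (Suc t)} \<and> Om (Suc t) = Om t - {obs (Suc t)}) \<and>
        (obs (Suc t) \<in> Op t \<longrightarrow> Op (Suc t) = Op t \<and> Om (Suc t) = Om t))"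

(* Only the values of \<mu> on the sigma-algebra F matter; finiteness is built into the
   codomain real. The library's countably_additive is restricted to ennreal-valued functions. *)
definition finite_signed_measure :: "'a set set \<Rightarrow> ('a set \<Rightarrow> real) \<Rightarrow> bool" where
  "finite_signed_measure F \<mu> \<longleftrightarrow>
     \<mu> {} = 0 \<and>
     (\<forall>A :: nat \<Rightarrow> 'a set. range A \<subseteq> F \<longrightarrow> disjoint_family A \<longrightarrow> (\<Union>i. A i) \<in> F \<longrightarrow>
        (\<lambda>i. \<mu> (A i)) sums \<mu> (\<Union>i. A i))"

definition induced_extended_probability ::
  "'a measure \<Rightarrow> 'a set \<Rightarrow> 'a set \<Rightarrow> ('a set \<Rightarrow> real) \<Rightarrow> bool" where
  "induced_extended_probability P Op0 Om0 \<mu> \<longleftrightarrow>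
     finite_signed_measure (sets P) \<mu> \<and>
     (\<forall>A\<in>sets P. \<mu> (A \<inter> Op0) = measure P (A \<inter> Op0) \<and> \<mu> (A \<inter> Om0) = - measure P (A \<inter> Om0))"

(* \<nu> is the update of \<mu> after observing w, where Op and Om are the actual and latent parts
   before the observation. On a countable \<Omega>, a signed measure on Pow \<Omega> is determined by its
   values on singletons. *)
definition extended_probability_update ::
  "'a set \<Rightarrow> 'a set \<Rightarrow> 'a set \<Rightarrow> 'a \<Rightarrow> ('a set \<Rightarrow> real) \<Rightarrow> ('a set \<Rightarrow> real) \<Rightarrow> bool" where
  "extended_probability_update \<Omega> Op Om w \<mu> \<nu> \<longleftrightarrow>
     (w \<in> Om \<longrightarrow>
        finite_signed_measure (Pow \<Omega>) \<nu> \<and>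
        \<nu> {w} = \<bar>\<mu> {w}\<bar> \<and> (\<forall>w'\<in>\<Omega>. w' \<noteq> w \<longrightarrow> \<nu> {w'} = \<mu> {w'})) \<and>
     (w \<in> Op \<longrightarrow> (\<forall>A\<in>Pow \<Omega>. \<nu> A = \<mu> A))"

(* The supremum is taken in ereal, so that it exists without a boundedness side condition. *)
definition d_ETV :: "'a set set \<Rightarrow> ('a set \<Rightarrow> real) \<Rightarrow> ('a set \<Rightarrow> real) \<Rightarrow> ereal" where
  "d_ETV F \<mu> \<nu> = (SUP A\<in>F. ereal \<bar>\<mu> A - \<nu> A\<bar>)"

end

theory Submission
  imports Defs
begin

text \<open>
  Both \<open>Pex t\<close> and the signed measure \<open>A \<mapsto> P (A \<inter> Op t) - P (A \<inter> Om t)\<close> are countably additive and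
  agree on singletons, hence agree everywhere. As the latent parts decrease, the difference to
  \<open>Pinf\<close> on \<open>A\<close> is \<open>-2 P (A \<inter> (Om t - \<Inter>t. Om t))\<close>, which is at most
  \<open>2 (P (Om t) - P (\<Inter>t. Om t))\<close> in absolute value, uniformly in \<open>A\<close>; continuity from above
  sends this bound to 0.
\<close>

text \<open>Countability lets \<open>A\<close> be cut into a sequence of pieces with at most one
  point each, so both values are sums of the same series.\<close>

lemma finite_signed_measure_eqI_countable:
  assumes \<Omega>: "countable \<Omega>"
    and \<mu>: "finite_signed_measure (Pow \<Omega>) \<mu>"
    and \<nu>: "finite_signed_measure (Pow \<Omega>) \<nu>"
    and single: "\<And>x. x \<in> \<Omega> \<Longrightarrow> \<mu> {x} = \<nu> {x}"
    and A: "A \<subseteq> \<Omega>"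
  shows "\<mu> A = \<nu> A"
proof -
  \<comment> \<open>The fibres of the injective coding of \<open>\<Omega>\<close>. Numbers that code
    no point of \<open>A\<close> give empty fibres, so finite and infinite \<open>A\<close> are
    covered by one \<open>nat\<close>-indexed family.\<close>
  define B where "B n = {x \<in> A. to_nat_on \<Omega> x = n}" for n
  have inj: "inj_on (to_nat_on \<Omega>) \<Omega>"
    using \<Omega> by (rule inj_on_to_nat_on)
  have B: "range B \<subseteq> Pow \<Omega>" "disjoint_family B" "(\<Union>n. B n) = A"
    using A by (auto simp: B_def disjoint_family_on_def)
  have sums: "(\<lambda>n. \<rho> (B n)) sums \<rho> A" if "finite_signed_measure (Pow \<Omega>) \<rho>" for \<rho>
    using that B(1,2) A unfolding finite_signed_measure_def B(3)[symmetric] by blast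
  have "\<mu> (B n) = \<nu> (B n)" for n
  proof (cases "B n = {}")
    case True
    then show ?thesis
      using \<mu> \<nu> by (simp add: finite_signed_measure_def)
  next
    case False
    then obtain x where x: "x \<in> B n" by blast
    then have "B n = {x}"
      using A inj by (auto simp: B_def inj_on_def)
    moreover have "x \<in> \<Omega>"
      using x A by (auto simp: B_def)
    ultimately show ?thesis
      using single by simp
  qed
  then show ?thesis
    using sums[OF \<mu>] sums[OF \<nu>] sums_unique2 by simp
qed

text \<open>Restricting a finite measure to a fixed set keeps it countably additive, and convergent
  series subtract termwise. This admits the closed form of the extended probability to the
  comparison on singletons.\<close>

lemma (in finite_measure) finite_signed_measure_diff_Int:
  assumes "X \<in> sets M" "Y \<in> sets M"
  shows "finite_signed_measure (sets M) (\<lambda>A. measure M (A \<inter> X) - measure M (A \<inter> Y))"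
proof -
  have "(\<lambda>i. measure M (A i \<inter> Z)) sums measure M ((\<Union>i. A i) \<inter> Z)"
    if "range A \<subseteq> sets M" "disjoint_family A" "Z \<in> sets M" for A :: "nat \<Rightarrow> 'a set" and Z
  proof -
    have "range (\<lambda>i. A i \<inter> Z) \<subseteq> sets M" "disjoint_family (\<lambda>i. A i \<inter> Z)"
      using that by (auto simp: disjoint_family_on_def)
    from finite_measure_UNION[OF this] show ?thesis
      by simp
  qed
  then show ?thesis
    using assms by (auto simp: finite_signed_measure_def intro!: sums_diff)
qed

lemma discovery_process_split:
  assumes "discovery_process \<Omega> Op Om obs"
  shows "\<Omega> = Om t \<union> Op t" "Om t \<inter> Op t = {}"
  using assms unfolding discovery_process_def by auto

lemma discovery_process_decseq:
  assumes "discovery_process \<Omega> Op Om obs"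
  shows "decseq Om"
proof (rule decseq_SucI)
  fix t
  show "Om (Suc t) \<subseteq> Om t"
    using assms unfolding discovery_process_def by blast
qed

text \<open>Induction on \<open>t\<close>. A discovery prescribes the new values on singletons only,
  so the formula is checked there and carried to all events by countable additivity.\<close>

lemma extended_probability_eq_diff:
  assumes "countable \<Omega>"
    and D: "discovery_process \<Omega> Op Om obs"
    and P: "prob_space P" "sets P = Pow \<Omega>"
    and init: "induced_extended_probability P (Op 0) (Om 0) (Pex 0)"
    and upd: "\<And>t. extended_probability_update \<Omega> (Op t) (Om t) (obs (Suc t)) (Pex t) (Pex (Suc t))"
    and "A \<subseteq> \<Omega>"
  shows "Pex t A = measure P (A \<inter> Op t) - measure P (A \<inter> Om t)"
proof -
  interpret prob_space P by fact
  have signed: "finite_signed_measure (Pow \<Omega>) (\<lambda>A. measure P (A \<inter> Op t) - measure P (A \<inter> Om t))" for t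
    using finite_signed_measure_diff_Int[of "Op t" "Om t"] P discovery_process_split[OF D, of t]
    by auto
  show ?thesis
    using \<open>A \<subseteq> \<Omega>\<close>
  proof (induction t arbitrary: A)
    case 0
    show ?case
    proof (rule finite_signed_measure_eqI_countable[OF \<open>countable \<Omega>\<close> _ signed _ 0])
      show "finite_signed_measure (Pow \<Omega>) (Pex 0)"
        using init P by (simp add: induced_extended_probability_def)
      fix x assume x: "x \<in> \<Omega>"
      \<comment> \<open>The defining equations at the event \<open>{x}\<close>. The one for the part
        containing \<open>x\<close> determines \<open>Pex 0 {x}\<close>.\<close>
      have *: "Pex 0 ({x} \<inter> Op 0) = measure P ({x} \<inter> Op 0)"
        "Pex 0 ({x} \<inter> Om 0) = - measure P ({x} \<inter> Om 0)"
        using init P x by (auto simp: induced_extended_probability_def)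
      show "Pex 0 {x} = measure P ({x} \<inter> Op 0) - measure P ({x} \<inter> Om 0)"
      proof (cases "x \<in> Op 0")
        case True
        then have "x \<notin> Om 0"
          using discovery_process_split(2)[OF D, of 0] by blast
        with True show ?thesis
          using *(1) by simp
      next
        case False
        then have "x \<in> Om 0"
          using x discovery_process_split(1)[OF D, of 0] by blast
        with False show ?thesis
          using *(2) by simp
      qed
    qed
  next
    case (Suc t)
    let ?w = "obs (Suc t)"
    have w: "?w \<in> \<Omega>"
      using D unfolding discovery_process_def by blast
    show ?case
    proof (cases "?w \<in> Om t")
      case True
      then have step: "Op (Suc t) = insert ?w (Op t)" "Om (Suc t) = Om t - {?w}"
        using D unfolding discovery_process_def by auto
      have new: "finite_signed_measure (Pow \<Omega>) (Pex (Suc t))" "Pex (Suc t) {?w} = \<bar>Pex t {?w}\<bar>"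
        "\<And>x. x \<in> \<Omega> \<Longrightarrow> x \<noteq> ?w \<Longrightarrow> Pex (Suc t) {x} = Pex t {x}"
        using upd[of t] True unfolding extended_probability_update_def by auto
      show ?thesis
      proof (rule finite_signed_measure_eqI_countable[OF \<open>countable \<Omega>\<close> new(1) signed _ Suc.prems])
        fix x assume x: "x \<in> \<Omega>"
        show "Pex (Suc t) {x} = measure P ({x} \<inter> Op (Suc t)) - measure P ({x} \<inter> Om (Suc t))"
        proof (cases "x = ?w")
          case True
          \<comment> \<open>Being latent, \<open>?w\<close> has the old value
            \<open>- measure P {?w}\<close> by the induction hypothesis. The absolute value flips
            the sign, just as moving \<open>?w\<close> into the actual part does in the
            formula.\<close>
          have "?w \<notin> Op t"
            using \<open>?w \<in> Om t\<close> discovery_process_split[OF D, of t] by blast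
          then show ?thesis
            using True x new(2) Suc.IH[of "{x}"] \<open>?w \<in> Om t\<close> by (simp add: step)
        next
          case False
          \<comment> \<open>Only \<open>?w\<close> changes sides; any other point keeps both its
            part and its value.\<close>
          then have "{x} \<inter> Op (Suc t) = {x} \<inter> Op t" "{x} \<inter> Om (Suc t) = {x} \<inter> Om t"
            by (auto simp: step)
          then show ?thesis
            using new(3)[OF x False] Suc.IH[of "{x}"] x by simp
        qed
      qed
    next
      case False
      then have "?w \<in> Op t"
        using w discovery_process_split[OF D, of t] by blast
      then have "Op (Suc t) = Op t" "Om (Suc t) = Om t" "Pex (Suc t) A = Pex t A"
        using D upd[of t] Suc.prems
        unfolding discovery_process_def extended_probability_update_def by auto
      then show ?thesis
        using Suc by simp
    qed
  qed
qed

theorem proposition15: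
  fixes \<Omega> :: "'a set"
    and Op Om :: "nat \<Rightarrow> 'a set"
    and obs :: "nat \<Rightarrow> 'a"
    and P :: "'a measure"
    and Pex :: "nat \<Rightarrow> 'a set \<Rightarrow> real"
    and Pinf :: "'a set \<Rightarrow> real"
  assumes "countable \<Omega>"
    and "discovery_process \<Omega> Op Om obs"
    and "prob_space P"
    and "space P = \<Omega>"
    and "sets P = Pow \<Omega>"
    and "induced_extended_probability P (Op 0) (Om 0) (Pex 0)"
    and "\<And>t. extended_probability_update \<Omega> (Op t) (Om t) (obs (Suc t)) (Pex t) (Pex (Suc t))"
    and "additive (Pow \<Omega>) Pinf"
    and "\<And>A. A \<in> Pow \<Omega> \<Longrightarrow> Pinf (A \<inter> (\<Union>t. Op t)) = measure P (A \<inter> (\<Union>t. Op t))"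
    and "\<And>A. A \<in> Pow \<Omega> \<Longrightarrow> Pinf (A \<inter> (\<Inter>t. Om t)) = - measure P (A \<inter> (\<Inter>t. Om t))"
  shows "(\<lambda>t. d_ETV (Pow \<Omega>) (Pex t) Pinf) \<longlonglongrightarrow> 0"
proof -
  interpret prob_space P by fact
  note D = assms(2) and sets = assms(5)
  define U where "U = (\<Union>t. Op t)"
  define N where "N = (\<Inter>t. Om t)"
  let ?b = "\<lambda>t. 2 * (measure P (Om t) - measure P N)"
  note split = discovery_process_split[OF D]
  have OM: "\<Omega> = N \<union> U" "N \<inter> U = {}"
    unfolding U_def N_def using split by blast+
  have meas: "X \<in> sets P" if "X \<subseteq> \<Omega>" for X
    using that sets by simp
  have N: "N \<subseteq> Om t" for t
    unfolding N_def by blast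
  have sub: "Om t \<subseteq> \<Omega>" "Op t \<subseteq> \<Omega>" for t
    using split[of t] by auto
  have bound: "\<bar>Pex t A - Pinf A\<bar> \<le> ?b t" if A: "A \<subseteq> \<Omega>" for A t
  proof -
    \<comment> \<open>The points latent at time \<open>t\<close> that are discovered later.\<close>
    let ?D = "Om t - N"
    \<comment> \<open>\<open>Pinf\<close> is prescribed only on events inside \<open>U\<close> or
      inside \<open>N\<close>; additivity gives its value on \<open>A\<close>.\<close>
    have "Pinf ((A \<inter> U) \<union> (A \<inter> N)) = Pinf (A \<inter> U) + Pinf (A \<inter> N)"
      using assms(8) A OM(2) by (intro additiveD) auto
    moreover have "(A \<inter> U) \<union> (A \<inter> N) = A"
      using A OM(1) by blast
    ultimately have inf: "Pinf A = measure P (A \<inter> U) - measure P (A \<inter> N)"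
      using assms(9,10)[folded U_def N_def] A by simp
    have "A \<inter> U = (A \<inter> Op t) \<union> (A \<inter> ?D)" "(A \<inter> Op t) \<inter> (A \<inter> ?D) = {}"
      using A OM split[of t] N[of t] by blast+
    then have O: "measure P (A \<inter> U) = measure P (A \<inter> Op t) + measure P (A \<inter> ?D)"
      using finite_measure_Union[of "A \<inter> Op t" "A \<inter> ?D"] meas[OF le_infI1[OF A]] by simp
    have "A \<inter> Om t = (A \<inter> N) \<union> (A \<inter> ?D)" "(A \<inter> N) \<inter> (A \<inter> ?D) = {}"
      using N[of t] by blast+
    then have M: "measure P (A \<inter> Om t) = measure P (A \<inter> N) + measure P (A \<inter> ?D)"
      using finite_measure_Union[of "A \<inter> N" "A \<inter> ?D"] meas[OF le_infI1[OF A]] by simp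
    have "Pex t A = measure P (A \<inter> Op t) - measure P (A \<inter> Om t)"
      using extended_probability_eq_diff[OF assms(1) D assms(3) sets assms(6,7) A] .
    \<comment> \<open>The mass of \<open>A \<inter> ?D\<close> enters \<open>Pinf A\<close> with a
      plus and \<open>Pex t A\<close> with a minus, hence the factor 2; the contributions of
      \<open>Op t\<close> and \<open>N\<close> cancel.\<close>
    then have "\<bar>Pex t A - Pinf A\<bar> = 2 * measure P (A \<inter> ?D)"
      using inf O M by simp
    also have "\<dots> \<le> 2 * measure P ?D"
      using sub(1)[of t] by (intro mult_left_mono finite_measure_mono meas) auto
    also have "measure P ?D = measure P (Om t) - measure P N"
      using sub(1)[of t] N[of t] by (intro finite_measure_Diff meas) auto
    finally show ?thesis .
  qed
  have "(\<lambda>t. measure P (Om t)) \<longlonglongrightarrow> measure P N"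
    unfolding N_def using sub meas discovery_process_decseq[OF D] by (intro finite_Lim_measure_decseq) auto
  then have "?b \<longlonglongrightarrow> 2 * (measure P N - measure P N)"
    by (intro tendsto_intros)
  then have lim: "(\<lambda>t. ereal (?b t)) \<longlonglongrightarrow> 0"
    by (simp add: zero_ereal_def)
  \<comment> \<open>A supremum in \<open>ereal\<close> is nonnegative once one member is; the event
    \<open>{}\<close> serves as the witness.\<close>
  have lower: "0 \<le> d_ETV (Pow \<Omega>) (Pex t) Pinf" for t
    unfolding d_ETV_def by (rule SUP_upper2[of "{}"]) auto
  have upper: "d_ETV (Pow \<Omega>) (Pex t) Pinf \<le> ereal (?b t)" for t
    unfolding d_ETV_def using bound by (intro SUP_least) auto
  show ?thesis
    by (rule tendsto_sandwich[OF always_eventually always_eventually tendsto_const lim])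
      (use lower upper in blast)+
qed

end
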